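(* Let $T$ be a finite tree and $\ell\ge 1$ an integer. Maker has a winning strategy in the $K_{1,\ell}$-game on $T$ if and only if there exists a subtree $T'$ of $T$ (a connected subgraph of $T$, possibly a single vertex) such that every vertex $x$ of $T'$ satisfies $d_T(x)\ge 2\ell-1-d_{T'}(x)$, where $d_T(x)$ and $d_{T'}(x)$ denote the degrees of $x$ in $T$ and in $T'$, respectively.
   Context: In a Maker-Breaker game on the edge set of a graph $G$, Maker and Breaker alternately claim previously unclaimed edges of $G$, Maker first, until all edges are claimed; Maker wins if she claims all edges of some winning set, and Breaker wins otherwise. In the $K_{1,\ell}$-game, the winning sets are the edge sets of subgraphs isomorphic to the star $K_{1,\ell}$; i.e. Maker wins if she claims $\ell$ edges incident to a common vertex. *)

theory Defs
  imports Main
begin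

definition simple_graph :: "'a set \<Rightarrow> 'a set set \<Rightarrow> bool" where
  "simple_graph V E \<longleftrightarrow> (\<forall>e\<in>E. \<exists>u\<in>V. \<exists>v\<in>V. u \<noteq> v \<and> e = {u, v})"

definition subgraph :: "'a set \<Rightarrow> 'a set set \<Rightarrow> 'a set \<Rightarrow> 'a set set \<Rightarrow> bool" where
  "subgraph W F V E \<longleftrightarrow> simple_graph W F \<and> W \<subseteq> V \<and> F \<subseteq> E"

definition vertex_degree :: "'a set set \<Rightarrow> 'a \<Rightarrow> nat" where
  "vertex_degree E x = card {e \<in> E. x \<in> e}"

definition connected_graph :: "'a set \<Rightarrow> 'a set set \<Rightarrow> bool" where
  "connected_graph V E \<longleftrightarrow> V \<noteq> {} \<and> (\<forall>u\<in>V. \<forall>v\<in>V. (u, v) \<in> {(x, y). {x, y} \<in> E}\<^sup>*)"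

definition graph_cycle :: "'a set set \<Rightarrow> 'a list \<Rightarrow> bool" where
  "graph_cycle E c \<longleftrightarrow> 3 \<le> length c \<and> distinct c \<and>
     (\<forall>i<length c. {c ! i, c ! (Suc i mod length c)} \<in> E)"

definition finite_tree :: "'a set \<Rightarrow> 'a set set \<Rightarrow> bool" where
  "finite_tree V E \<longleftrightarrow> finite V \<and> simple_graph V E \<and> connected_graph V E \<and> (\<nexists>c. graph_cycle E c)"

definition isomorphic :: "'a set \<Rightarrow> 'a set set \<Rightarrow> 'b set \<Rightarrow> 'b set set \<Rightarrow> bool" where
  "isomorphic V E V' E' \<longleftrightarrow> (\<exists>f. bij_betw f V V' \<and> E' = (\<lambda>e. f ` e) ` E)"

definition star_verts :: "nat \<Rightarrow> nat set" where
  "star_verts l = {0..l}"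

definition star_edges :: "nat \<Rightarrow> nat set set" where
  "star_edges l = {{0, i} | i. i \<in> {1..l}}"

definition star_winning_sets :: "'a set \<Rightarrow> 'a set set \<Rightarrow> nat \<Rightarrow> 'a set set set" where
  "star_winning_sets V E l =
     {F. \<exists>W. subgraph W F V E \<and> isomorphic (star_verts l) (star_edges l) W F}"

text \<open>
  A position of the Maker-Breaker game on a finite board \<open>X\<close> is the list of the elements claimed
  so far, in the order in which they were claimed. Maker moves first, so she claims the entries
  with even index. A finished play is an enumeration of \<open>X\<close>.
\<close>

definition position :: "'b set \<Rightarrow> 'b list \<Rightarrow> bool" where
  "position X p \<longleftrightarrow> distinct p \<and> set p \<subseteq> X"

definition finished_play :: "'b set \<Rightarrow> 'b list \<Rightarrow> bool" where
  "finished_play X p \<longleftrightarrow> distinct p \<and> set p = X"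

definition maker_claims :: "'b list \<Rightarrow> 'b set" where
  "maker_claims p = {p ! i | i. i < length p \<and> even i}"

definition maker_strategy :: "'b set \<Rightarrow> ('b list \<Rightarrow> 'b) \<Rightarrow> bool" where
  "maker_strategy X s \<longleftrightarrow>
     (\<forall>p. position X p \<and> even (length p) \<and> set p \<noteq> X \<longrightarrow> s p \<in> X - set p)"

definition follows :: "('b list \<Rightarrow> 'b) \<Rightarrow> 'b list \<Rightarrow> bool" where
  "follows s p \<longleftrightarrow> (\<forall>i<length p. even i \<longrightarrow> p ! i = s (take i p))"

definition maker_has_winning_strategy :: "'b set \<Rightarrow> 'b set set \<Rightarrow> bool" where
  "maker_has_winning_strategy X \<W> \<longleftrightarrow>
     (\<exists>s. maker_strategy X s \<and>
        (\<forall>p. finished_play X p \<and> follows s p \<longrightarrow> (\<exists>A\<in>\<W>. A \<subseteq> maker_claims p)))"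

end

theory Submission
  imports Defs
begin

text \<open>
  For a position with Maker's edges \<open>M\<close> and Breaker's edges \<open>B\<close>, let
  \<open>w(x) = d\<^sub>E(x) + d\<^sub>M(x) - d\<^sub>B(x) - (2l - 1)\<close>. With Maker to move, the position is won for her iff
  some subtree \<open>(W, F)\<close> of unclaimed edges satisfies \<open>w(x) + d\<^sub>F(x) \<ge> 0\<close> on \<open>W\<close>. Each Maker edge
  raises \<open>w\<close> by one at both ends and each Breaker edge lowers it, so Maker keeps such a subtree by
  claiming one of its edges (or, if it is a single vertex, an edge there), while Breaker keeps it
  from appearing by answering at the endangered end of Maker's last edge. Once all edges are
  claimed, \<open>w(x) = 2 d\<^sub>M(x) - 2l + 1\<close>, which is nonnegative iff \<open>d\<^sub>M(x) \<ge> l\<close>.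
\<close>

section \<open>Maker-Breaker games and invariants\<close>

text \<open>Taken as a complement rather than by odd indices, so that with
  \<open>maker_claims\<close> it splits \<open>set p\<close> into two disjoint parts at
  once.\<close>

definition breaker_claims :: "'b list \<Rightarrow> 'b set" where
  "breaker_claims p = set p - maker_claims p"

lemma maker_claims_Nil [simp]: "maker_claims [] = {}"
  by (simp add: maker_claims_def)

lemma maker_claims_snoc:
  "maker_claims (p @ [a]) = (if even (length p) then insert a (maker_claims p) else maker_claims p)"
proof -
  have image: "maker_claims q = (!) q ` {i. i < length q \<and> even i}" for q :: "'a list"
    by (auto simp: maker_claims_def)
  have "{i. i < length (p @ [a]) \<and> even i} =
      (if even (length p) then insert (length p) {i. i < length p \<and> even i}
       else {i. i < length p \<and> even i})"
    by (auto simp: less_Suc_eq)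
  moreover have "(!) (p @ [a]) ` {i. i < length p \<and> even i} = maker_claims p"
    unfolding image by (intro image_cong) (auto simp: nth_append)
  ultimately show ?thesis
    unfolding image[of "p @ [a]"] by simp
qed

lemma maker_claims_subset: "maker_claims p \<subseteq> set p"
  by (auto simp: maker_claims_def)

lemma breaker_claims_Nil [simp]: "breaker_claims [] = {}"
  by (simp add: breaker_claims_def)

lemma breaker_claims_snoc:
  assumes "distinct (p @ [a])"
  shows "breaker_claims (p @ [a]) =
    (if even (length p) then breaker_claims p else insert a (breaker_claims p))"
  using assms maker_claims_subset[of p] by (auto simp: breaker_claims_def maker_claims_snoc)

lemma claims_Un: "maker_claims p \<union> breaker_claims p = set p"
  using maker_claims_subset[of p] by (auto simp: breaker_claims_def)

lemma claims_disjoint: "maker_claims p \<inter> breaker_claims p = {}"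
  by (auto simp: breaker_claims_def)

lemma follows_snoc:
  "follows s (p @ [a]) \<longleftrightarrow> follows s p \<and> (even (length p) \<longrightarrow> a = s p)"
  unfolding follows_def by (auto simp: nth_append less_Suc_eq)

lemma position_snoc: "position X (p @ [a]) \<longleftrightarrow> position X p \<and> a \<in> X - set p"
  by (auto simp: position_def)

section \<open>Winning criteria by invariants\<close>

text \<open>Choosing at each turn a move that is safe against every reply gives a strategy, and the
  invariant survives to the end of the play. The conjunct \<open>I (insert e M) B\<close> serves the
  case that Maker's move fills the board.\<close>

lemma maker_wins_by_invariant:
  assumes start: "I {} {}"
    and move: "\<And>M B. \<lbrakk>I M B; M \<inter> B = {}; M \<union> B \<subset> X\<rbrakk> \<Longrightarrow>
      \<exists>e\<in>X - (M \<union> B). I (insert e M) B \<and>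
        (\<forall>f\<in>X - insert e (M \<union> B). I (insert e M) (insert f B))"
    and final: "\<And>M B. \<lbrakk>I M B; M \<inter> B = {}; M \<union> B = X\<rbrakk> \<Longrightarrow> \<exists>A\<in>\<W>. A \<subseteq> M"
  shows "maker_has_winning_strategy X \<W>"
proof -
  define good where "good p e \<longleftrightarrow> e \<in> X - set p \<and> I (insert e (maker_claims p)) (breaker_claims p) \<and>
      (\<forall>f\<in>X - insert e (set p). I (insert e (maker_claims p)) (insert f (breaker_claims p)))" for p e
  \<comment> \<open>The second choice is a default: a strategy must be legal at every position,
    including those where the invariant fails.\<close>
  define s where "s p = (if \<exists>e. good p e then SOME e. good p e else SOME e. e \<in> X - set p)" for p
  have good: "good p (s p)" if "position X p" "set p \<noteq> X" "I (maker_claims p) (breaker_claims p)" for p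
  proof -
    have "\<exists>e. good p e"
      using move[OF that(3) claims_disjoint] that(1,2) claims_Un[of p]
      by (auto simp: good_def position_def)
    then show ?thesis
      unfolding s_def by (simp add: someI_ex[of "good p"])
  qed
  have strategy: "maker_strategy X s"
    unfolding maker_strategy_def
  proof (intro allI impI, elim conjE)
    fix p assume p: "position X p" "set p \<noteq> X"
    show "s p \<in> X - set p"
    proof (cases "\<exists>e. good p e")
      case True
      then have "good p (s p)" unfolding s_def by (simp add: someI_ex[of "good p"])
      then show ?thesis by (simp add: good_def)
    next
      case False
      have "\<exists>e. e \<in> X - set p" using p by (auto simp: position_def)
      then have "(SOME e. e \<in> X - set p) \<in> X - set p" by (rule someI_ex)
      then show ?thesis using False by (simp add: s_def)
    qed
  qed
  \<comment> \<open>The induction adds one claim at a time, so at odd length it must also remember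
    that every Breaker reply is safe.\<close>
  have inv: "I (maker_claims p) (breaker_claims p) \<and>
      (odd (length p) \<longrightarrow> (\<forall>f\<in>X - set p. I (maker_claims p) (insert f (breaker_claims p))))"
    if "position X p" "follows s p" for p
    using that
  proof (induction p rule: rev_induct)
    case Nil
    then show ?case using start by simp
  next
    case (snoc a p)
    then have IH: "I (maker_claims p) (breaker_claims p)"
        "odd (length p) \<Longrightarrow> \<forall>f\<in>X - set p. I (maker_claims p) (insert f (breaker_claims p))"
      and p: "position X p" "a \<in> X - set p" and d: "distinct (p @ [a])"
      by (auto simp: position_snoc follows_snoc position_def)
    show ?case
    proof (cases "even (length p)")
      case True
      then have "a = s p" using snoc.prems by (simp add: follows_snoc)
      then have "good p a" using good[OF p(1) _ IH(1)] p(2) by auto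
      then show ?thesis
        using True by (simp add: good_def maker_claims_snoc breaker_claims_snoc[OF d])
    next
      case False
      then show ?thesis
        using IH p by (simp add: maker_claims_snoc breaker_claims_snoc[OF d])
    qed
  qed
  show ?thesis
    unfolding maker_has_winning_strategy_def
  proof (intro exI conjI allI impI, rule strategy, elim conjE)
    fix p assume "finished_play X p" "follows s p"
    then have p: "position X p" "set p = X" by (auto simp: finished_play_def position_def)
    show "\<exists>A\<in>\<W>. A \<subseteq> maker_claims p"
      using final[of "maker_claims p" "breaker_claims p"] inv[OF p(1) \<open>follows s p\<close>] p(2)
      by (simp add: claims_disjoint claims_Un)
  qed
qed

text \<open>No Breaker strategy is built: against a given Maker strategy, one finished play that
  follows it and keeps the invariant is enough. The case split in \<open>move\<close> is for boards
  on which Maker claims last.\<close>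

lemma breaker_wins_by_invariant:
  assumes "finite X"
    and start: "I {} {}"
    and move: "\<And>M B e. \<lbrakk>I M B; M \<inter> B = {}; M \<union> B \<subseteq> X; e \<in> X - (M \<union> B)\<rbrakk> \<Longrightarrow>
      if X = insert e (M \<union> B) then I (insert e M) B
      else \<exists>f\<in>X - insert e (M \<union> B). I (insert e M) (insert f B)"
    and final: "\<And>M B. \<lbrakk>I M B; M \<inter> B = {}; M \<union> B = X\<rbrakk> \<Longrightarrow> \<not> (\<exists>A\<in>\<W>. A \<subseteq> M)"
  shows "\<not> maker_has_winning_strategy X \<W>"
proof
  assume "maker_has_winning_strategy X \<W>"
  then obtain s where s: "maker_strategy X s"
    and win: "\<And>p. finished_play X p \<Longrightarrow> follows s p \<Longrightarrow> \<exists>A\<in>\<W>. A \<subseteq> maker_claims p"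
    by (auto simp: maker_has_winning_strategy_def)
  \<comment> \<open>Generalised from the empty position to all positions with Maker to move, for
    induction on the number of unclaimed elements.\<close>
  have "\<exists>q. finished_play X q \<and> follows s q \<and> I (maker_claims q) (breaker_claims q)"
    if "position X p" "follows s p" "even (length p)" "I (maker_claims p) (breaker_claims p)" for p
    using that
  proof (induction "card (X - set p)" arbitrary: p rule: less_induct)
    case less
    show ?case
    proof (cases "set p = X")
      case True
      then show ?thesis using less.prems by (auto simp: finished_play_def position_def)
    next
      case False
      define e where "e = s p"
      have e: "e \<in> X - set p"
        using s less.prems False by (simp add: maker_strategy_def e_def)
      have pos: "position X (p @ [e])" and fol: "follows s (p @ [e])"
        using less.prems e by (auto simp: position_snoc follows_snoc e_def)
      have sub: "set p \<subseteq> X" using less.prems by (simp add: position_def)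
      have d: "distinct (p @ [e])" using pos by (simp add: position_def)
      have claims: "maker_claims (p @ [e]) = insert e (maker_claims p)"
          "breaker_claims (p @ [e]) = breaker_claims p"
        using less.prems by (simp_all add: maker_claims_snoc breaker_claims_snoc[OF d])
      have mv: "if X = insert e (set p) then I (insert e (maker_claims p)) (breaker_claims p)
        else \<exists>f\<in>X - insert e (set p). I (insert e (maker_claims p)) (insert f (breaker_claims p))"
        using move[OF less.prems(4) claims_disjoint, unfolded claims_Un] e sub by blast
      show ?thesis
      proof (cases "X = insert e (set p)")
        case True
        then show ?thesis using mv fol claims d
          by (intro exI[of _ "p @ [e]"]) (auto simp: finished_play_def)
      next
        case False
        then obtain f where f: "f \<in> X - insert e (set p)"
          and I: "I (insert e (maker_claims p)) (insert f (breaker_claims p))"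
          using mv by auto
        let ?q = "(p @ [e]) @ [f]"
        have pos': "position X ?q" and fol': "follows s ?q"
          using pos fol f less.prems(3)
          unfolding position_snoc[of X "p @ [e]"] follows_snoc[of s "p @ [e]"] by auto
        have d': "distinct ?q" using pos' by (simp only: position_def)
        have "maker_claims ?q = insert e (maker_claims p)"
            "breaker_claims ?q = insert f (breaker_claims p)"
          using less.prems(3) claims
          unfolding maker_claims_snoc[of "p @ [e]"] breaker_claims_snoc[OF d'] by simp_all
        moreover have "card (X - set ?q) < card (X - set p)"
          using e \<open>finite X\<close> by (intro psubset_card_mono) auto
        moreover have "even (length ?q)" using less.prems(3) by simp
        ultimately show ?thesis using less.hyps[OF _ pos' fol'] I by simp
      qed
    qed
  qed
  from this[of "[]"] obtain q where q: "finished_play X q" "follows s q"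
    "I (maker_claims q) (breaker_claims q)"
    using start by (auto simp: position_def follows_def)
  then show False
    using win[OF q(1,2)] final[OF q(3) claims_disjoint] claims_Un[of q]
    by (auto simp: finished_play_def)
qed

section \<open>Degrees, stars and bridges\<close>

lemma vertex_degree_empty [simp]: "vertex_degree {} x = 0"
  by (simp add: vertex_degree_def)

lemma vertex_degree_insert:
  assumes "finite M" "e \<notin> M"
  shows "vertex_degree (insert e M) x = (if x \<in> e then Suc (vertex_degree M x) else vertex_degree M x)"
proof -
  have "{d \<in> insert e M. x \<in> d} = (if x \<in> e then insert e {d \<in> M. x \<in> d} else {d \<in> M. x \<in> d})"
    by auto
  then show ?thesis using assms by (simp add: vertex_degree_def)
qed

lemma vertex_degree_mono: "finite N \<Longrightarrow> M \<subseteq> N \<Longrightarrow> vertex_degree M x \<le> vertex_degree N x"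
  unfolding vertex_degree_def by (intro card_mono) auto

lemma vertex_degree_Un:
  assumes "finite M" "finite B" "M \<inter> B = {}"
  shows "vertex_degree (M \<union> B) x = vertex_degree M x + vertex_degree B x"
proof -
  have "{e \<in> M \<union> B. x \<in> e} = {e \<in> M. x \<in> e} \<union> {e \<in> B. x \<in> e}" by auto
  then show ?thesis
    unfolding vertex_degree_def using assms by (simp add: card_Un_disjoint disjoint_iff)
qed

lemma simple_graph_edgeE:
  assumes "simple_graph V E" "e \<in> E"
  obtains x y where "e = {x, y}" "x \<noteq> y" "x \<in> V" "y \<in> V"
  using assms by (auto simp: simple_graph_def)

lemma simple_graph_other_endE:
  assumes "simple_graph V E" "e \<in> E" "x \<in> e"
  obtains y where "e = {x, y}" "y \<noteq> x" "y \<in> V"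
proof -
  obtain a b where ab: "e = {a, b}" "a \<noteq> b" "a \<in> V" "b \<in> V"
    using assms(1,2) by (rule simple_graph_edgeE)
  show thesis
  proof (cases "x = a")
    case True
    then show thesis using ab that[of b] by simp
  next
    case False
    then show thesis using ab assms(3) that[of a] by (simp add: insert_commute)
  qed
qed

section \<open>Stars and vertices of large degree\<close>

lemma star_edges_image: "star_edges l = (\<lambda>i. {0, i}) ` {1..l}"
  by (auto simp: star_edges_def)

text \<open>In a simple graph an edge at \<open>x\<close> is determined by its other end, so any
  \<open>l\<close> edges at \<open>x\<close> form a star, and a star has \<open>l\<close> distinct
  edges at its centre.\<close>

lemma star_winning_set_iff:
  assumes E: "simple_graph V E" "finite E" and M: "M \<subseteq> E" and l: "l \<ge> 1"
  shows "(\<exists>A\<in>star_winning_sets V E l. A \<subseteq> M) \<longleftrightarrow> (\<exists>x\<in>V. l \<le> vertex_degree M x)"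
proof
  assume "\<exists>A\<in>star_winning_sets V E l. A \<subseteq> M"
  then obtain A W f where A: "A \<subseteq> M" "subgraph W A V E" "bij_betw f (star_verts l) W"
    "A = (\<lambda>e. f ` e) ` star_edges l"
    by (auto simp: star_winning_sets_def isomorphic_def)
  have inj: "inj_on f {0..l}" using A(3) by (simp add: bij_betw_def star_verts_def)
  have A_eq: "A = (\<lambda>i. {f 0, f i}) ` {1..l}"
    by (simp add: A(4) star_edges_image image_image)
  have "inj_on (\<lambda>i. {f 0, f i}) {1..l}"
    using inj by (auto simp: inj_on_def doubleton_eq_iff)
  then have "card A = l" by (simp add: A_eq card_image)
  moreover have "A \<subseteq> {e \<in> M. f 0 \<in> e}" using A(1) A_eq by auto
  moreover have "finite {e \<in> M. f 0 \<in> e}" using finite_subset[OF M E(2)] by simp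
  ultimately have "l \<le> vertex_degree M (f 0)"
    unfolding vertex_degree_def by (metis card_mono)
  moreover have "f 0 \<in> V"
    using A(2,3) by (auto simp: subgraph_def bij_betw_def star_verts_def)
  ultimately show "\<exists>x\<in>V. l \<le> vertex_degree M x" by blast
next
  assume "\<exists>x\<in>V. l \<le> vertex_degree M x"
  then obtain x where x: "x \<in> V" "l \<le> card {e \<in> M. x \<in> e}" by (auto simp: vertex_degree_def)
  then obtain A where A: "A \<subseteq> {e \<in> M. x \<in> e}" "card A = l" "finite A"
    using obtain_subset_with_card_n[OF x(2)] by blast
  then obtain h where h: "bij_betw h {1..l} A"
    using finite_same_card_bij[of "{1..l}" A] by auto
  have "\<exists>y\<in>V. e = {x, y} \<and> y \<noteq> x" if "e \<in> A" for e
    using that A(1) M simple_graph_other_endE[OF E(1)] by blast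
  then obtain y where y: "\<And>e. e \<in> A \<Longrightarrow> y e \<in> V \<and> e = {x, y e} \<and> y e \<noteq> x" by metis
  \<comment> \<open>The centre \<open>0\<close> goes to \<open>x\<close>, and leaf \<open>i\<close>
    to the far end of the edge numbered \<open>i\<close>.\<close>
  define f where "f i = (if i = 0 then x else y (h i))" for i
  have hA: "h i \<in> A" if "i \<in> {1..l}" for i using h that by (auto simp: bij_betw_def)
  have inj: "inj_on f {0..l}"
  proof (rule inj_onI)
    fix i j assume ij: "i \<in> {0..l}" "j \<in> {0..l}" "f i = f j"
    show "i = j"
    proof (cases "i = 0 \<or> j = 0")
      case True
      then show ?thesis using ij y[OF hA[of i]] y[OF hA[of j]] by (auto simp: f_def split: if_splits)
    next
      case False
      then have mem: "i \<in> {1..l}" "j \<in> {1..l}" and "y (h i) = y (h j)"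
        using ij by (auto simp: f_def)
      then have "h i = h j" using y[OF hA[of i]] y[OF hA[of j]] by metis
      then show ?thesis using bij_betw_imp_inj_on[OF h] mem by (meson inj_onD)
    qed
  qed
  have A_eq: "A = (\<lambda>e. f ` e) ` star_edges l"
  proof -
    have "f ` {0, i} = h i" if "i \<in> {1..l}" for i
      using y[OF hA[OF that]] that by (auto simp: f_def)
    then have "(\<lambda>e. f ` e) ` star_edges l = h ` {1..l}"
      unfolding star_edges_image image_image by (intro image_cong) auto
    then show ?thesis using h by (simp add: bij_betw_def)
  qed
  have "isomorphic (star_verts l) (star_edges l) (f ` {0..l}) A"
    unfolding isomorphic_def using inj A_eq by (auto simp: bij_betw_def star_verts_def)
  moreover have "subgraph (f ` {0..l}) A V E"
  proof -
    have "f ` {0..l} \<subseteq> V" using x(1) y hA by (auto simp: f_def)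
    moreover have "simple_graph (f ` {0..l}) A"
      unfolding simple_graph_def
    proof
      fix e assume "e \<in> A"
      then obtain i where i: "i \<in> {1..l}" "e = h i" using h by (auto simp: bij_betw_def)
      then have "f 0 \<noteq> f i" "e = {f 0, f i}" using y[OF hA[OF i(1)]] by (auto simp: f_def)
      then show "\<exists>u\<in>f ` {0..l}. \<exists>v\<in>f ` {0..l}. u \<noteq> v \<and> e = {u, v}"
        using i(1) by (intro bexI[of _ "f 0"] bexI[of _ "f i"]) auto
    qed
    ultimately show ?thesis using A(1) M by (auto simp: subgraph_def)
  qed
  ultimately show "\<exists>A\<in>star_winning_sets V E l. A \<subseteq> M"
    using A(1) by (auto simp: star_winning_sets_def)
qed

section \<open>Reachability and bridges\<close>

definition reachable :: "'a set set \<Rightarrow> ('a \<times> 'a) set" where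
  "reachable E = {(x, y). {x, y} \<in> E}\<^sup>*"

lemma reachable_sym: "(x, y) \<in> reachable E \<Longrightarrow> (y, x) \<in> reachable E"
  unfolding reachable_def
  by (rule symD[OF sym_rtrancl]) (auto simp: sym_def insert_commute)

lemma reachable_trans: "(x, y) \<in> reachable E \<Longrightarrow> (y, z) \<in> reachable E \<Longrightarrow> (x, z) \<in> reachable E"
  by (simp add: reachable_def)

lemma reachable_edge: "{x, y} \<in> E \<Longrightarrow> (x, y) \<in> reachable E"
  by (auto simp: reachable_def)

lemma reachable_mono: "E \<subseteq> F \<Longrightarrow> reachable E \<subseteq> reachable F"
  unfolding reachable_def by (intro rtrancl_mono) auto

lemma reachable_refl [simp]: "(x, x) \<in> reachable E"
  by (simp add: reachable_def)

lemma connected_graph_reachable: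
  "connected_graph V E \<longleftrightarrow> V \<noteq> {} \<and> (\<forall>u\<in>V. \<forall>v\<in>V. (u, v) \<in> reachable E)"
  by (simp add: connected_graph_def reachable_def)

lemma connected_graph_from_vertex:
  assumes "x \<in> V" "\<And>z. z \<in> V \<Longrightarrow> (x, z) \<in> reachable E"
  shows "connected_graph V E"
  unfolding connected_graph_reachable
proof (intro conjI ballI)
  show "V \<noteq> {}" using assms(1) by blast
  show "(u, v) \<in> reachable E" if "u \<in> V" "v \<in> V" for u v
    using reachable_trans[OF reachable_sym] assms(2) that by metis
qed

text \<open>A walk is extended edge by edge; whenever it returns to a vertex, the loop is cut
  off.\<close>

lemma reachable_distinct_path:
  assumes "(x, y) \<in> reachable E"
  shows "\<exists>p. p \<noteq> [] \<and> hd p = x \<and> last p = y \<and> distinct p \<and>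
    (\<forall>i. Suc i < length p \<longrightarrow> {p ! i, p ! Suc i} \<in> E)"
  using assms unfolding reachable_def
proof (induction rule: rtrancl_induct)
  case base
  show ?case by (intro exI[of _ "[x]"]) auto
next
  case (step y z)
  then obtain p where p: "p \<noteq> []" "hd p = x" "last p = y" "distinct p"
    "\<And>i. Suc i < length p \<Longrightarrow> {p ! i, p ! Suc i} \<in> E" by blast
  show ?case
  proof (cases "z \<in> set p")
    case True
    then obtain k where k: "k < length p" "p ! k = z" by (auto simp: in_set_conv_nth)
    \<comment> \<open>The path is truncated at the earlier visit to \<open>z\<close>.\<close>
    then have "last (take (Suc k) p) = z" by (simp add: take_Suc_conv_app_nth)
    then show ?thesis using p k
      by (intro exI[of _ "take (Suc k) p"]) (auto simp: hd_conv_nth)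
  next
    case False
    have "{(p @ [z]) ! i, (p @ [z]) ! Suc i} \<in> E" if "Suc i < length (p @ [z])" for i
    proof (cases "Suc i < length p")
      case True
      then show ?thesis using p(5)[of i] by (simp add: nth_append)
    next
      case False
      then have "Suc i = length p" using that by simp
      then have "p ! i = y" "i < length p" using p(1,3) by (auto simp: last_conv_nth simp flip: \<open>Suc i = length p\<close>)
      then show ?thesis using step(2) \<open>Suc i = length p\<close> by (simp add: nth_append)
    qed
    then show ?thesis using p False by (intro exI[of _ "p @ [z]"]) auto
  qed
qed

text \<open>A path from \<open>x\<close> to \<open>y\<close> that avoids the edge would be closed by
  it to a cycle.\<close>

lemma acyclic_edge_is_bridge:
  assumes "\<nexists>c. graph_cycle E c" "{x, y} \<in> E" "x \<noteq> y"
  shows "(x, y) \<notin> reachable (E - {{x, y}})"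
proof
  assume "(x, y) \<in> reachable (E - {{x, y}})"
  then obtain p where p: "p \<noteq> []" "hd p = x" "last p = y" "distinct p"
    "\<And>i. Suc i < length p \<Longrightarrow> {p ! i, p ! Suc i} \<in> E - {{x, y}}"
    using reachable_distinct_path by metis
  have ends: "p ! 0 = x" "p ! (length p - 1) = y"
    using p(1-3) by (simp_all add: hd_conv_nth last_conv_nth)
  have "length p \<noteq> 0" "length p \<noteq> 1" using p(1) ends assms(3) by auto
  \<comment> \<open>A path on two vertices would consist of the deleted edge alone; this yields the
    length 3 that \<open>graph_cycle\<close> demands.\<close>
  moreover have "length p \<noteq> 2" using p(5)[of 0] ends by (auto simp: numeral_2_eq_2)
  ultimately have len: "3 \<le> length p" by linarith
  have "{p ! i, p ! (Suc i mod length p)} \<in> E" if "i < length p" for i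
  proof (cases "Suc i < length p")
    case True
    then show ?thesis using p(5)[of i] by simp
  next
    case False
    then have "Suc i = length p" using that by simp
    \<comment> \<open>At the last index the successor wraps around to \<open>0\<close>, so the
      closing edge is \<open>{y, x}\<close>.\<close>
    then have "p ! i = y" "Suc i mod length p = 0" using ends by (metis diff_Suc_1, simp)
    then show ?thesis using ends assms(2) by (simp add: insert_commute)
  qed
  then have "graph_cycle E p" using len p(4) by (simp add: graph_cycle_def)
  then show False using assms(1) by blast
qed

section \<open>The star game on a tree\<close>

locale tree_star_game =
  fixes V :: "'a set" and E :: "'a set set" and l :: nat
  assumes tree: "finite_tree V E"
begin

lemma simple: "simple_graph V E"
  using tree by (simp add: finite_tree_def)

lemma finite_E: "finite E"
proof (rule finite_subset)
  show "E \<subseteq> Pow V" using simple by (auto simp: simple_graph_def)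
  show "finite (Pow V)" using tree by (simp add: finite_tree_def)
qed

lemma finite_subset_E: "M \<subseteq> E \<Longrightarrow> finite M"
  by (rule finite_subset[OF _ finite_E])

lemma bridge: "\<lbrakk>{x, y} \<in> E; x \<noteq> y\<rbrakk> \<Longrightarrow> (x, y) \<notin> reachable (E - {{x, y}})"
  using tree by (intro acyclic_edge_is_bridge) (simp_all add: finite_tree_def)

section \<open>Witness subtrees and live positions\<close>

text \<open>The inequality is \<open>w(x) + d_F(x) \<ge> 0\<close> with the negative terms moved
  across, which avoids truncated subtraction. For empty \<open>M\<close> and \<open>B\<close> it is
  the degree condition on the subtree in the theorem.\<close>

definition witness :: "'a set set \<Rightarrow> 'a set set \<Rightarrow> 'a set \<Rightarrow> 'a set set \<Rightarrow> bool" where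
  "witness M B W F \<longleftrightarrow> subgraph W F V E \<and> connected_graph W F \<and> F \<inter> (M \<union> B) = {} \<and>
    (\<forall>x\<in>W. 2 * l + vertex_degree B x \<le> Suc (vertex_degree E x + vertex_degree M x + vertex_degree F x))"

definition live :: "'a set set \<Rightarrow> 'a set set \<Rightarrow> bool" where
  "live M B \<longleftrightarrow> (\<exists>W F. witness M B W F)"

lemma witness_edges:
  assumes "witness M B W F"
  shows "F \<subseteq> E" "F \<inter> (M \<union> B) = {}" "finite F" "simple_graph W F" "W \<subseteq> V"
  using assms finite_subset_E[of F] by (auto simp: witness_def subgraph_def)

lemma witness_reachable: "\<lbrakk>witness M B W F; u \<in> W; v \<in> W\<rbrakk> \<Longrightarrow> (u, v) \<in> reachable F"
  by (simp add: witness_def connected_graph_reachable)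

lemma witness_antimono:
  assumes "witness M B' W F" "B \<subseteq> B'" "B' \<subseteq> E"
  shows "witness M B W F"
proof -
  have "2 * l + vertex_degree B x \<le> Suc (vertex_degree E x + vertex_degree M x + vertex_degree F x)"
    if "x \<in> W" for x
  proof -
    have "vertex_degree B x \<le> vertex_degree B' x"
      using assms(2) finite_subset_E[OF assms(3)] by (intro vertex_degree_mono)
    moreover have "2 * l + vertex_degree B' x \<le>
        Suc (vertex_degree E x + vertex_degree M x + vertex_degree F x)"
      using assms(1) that by (simp add: witness_def)
    ultimately show ?thesis by linarith
  qed
  moreover have "F \<inter> (M \<union> B) = {}" using witness_edges(2)[OF assms(1)] assms(2) by blast
  ultimately show ?thesis using assms(1) by (simp add: witness_def)
qed

lemma witness_singleton_iff:
  "witness M B {x} {} \<longleftrightarrow>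
    x \<in> V \<and> 2 * l + vertex_degree B x \<le> Suc (vertex_degree E x + vertex_degree M x)"
  by (auto simp: witness_def subgraph_def simple_graph_def connected_graph_def)

text \<open>All edges of \<open>F\<close> have their ends in \<open>W\<close>, so \<open>f\<close>
  is not among them, and it changes no degree on \<open>W\<close>.\<close>

lemma witness_untouched:
  assumes "witness M B W F" "f \<inter> W = {}" "f \<notin> B" "B \<subseteq> E"
  shows "witness M (insert f B) W F"
proof -
  have "f \<notin> F" using witness_edges(4)[OF assms(1)] assms(2) by (auto simp: simple_graph_def)
  moreover have "vertex_degree (insert f B) x = vertex_degree B x" if "x \<in> W" for x
    using that assms finite_subset_E by (auto simp: vertex_degree_insert)
  ultimately show ?thesis using assms(1) by (auto simp: witness_def)
qed

section \<open>Maker's move: splitting a witness\<close>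

text \<open>Claiming \<open>{x, y}\<close> trades one unit of \<open>F\<close>-degree for one of
  \<open>M\<close>-degree at its ends, and the component of \<open>x\<close> left in
  \<open>F\<close> keeps all other \<open>F\<close>-edges at its vertices.\<close>

lemma witness_split:
  assumes w: "witness M B W F" and e: "{x, y} \<in> F" "x \<noteq> y" and M: "M \<subseteq> E"
  shows "\<exists>F'. witness (insert {x, y} M) B {z \<in> W. (x, z) \<in> reachable (F - {{x, y}})} F'"
proof
  define W' where "W' = {z \<in> W. (x, z) \<in> reachable (F - {{x, y}})}"
  define F' where "F' = {e \<in> F - {{x, y}}. e \<subseteq> W'}"
  note we = witness_edges[OF w]
  have xW: "x \<in> W" using we(4) e by (auto simp: simple_graph_def doubleton_eq_iff)
  \<comment> \<open>Membership in \<open>W'\<close> and reachability inside \<open>F'\<close> are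
    proved together, since an edge of the walk lies in \<open>F'\<close> only once both its ends are
    known to lie in \<open>W'\<close>.\<close>
  have reach: "z \<in> W' \<and> (x, z) \<in> reachable F'" if "(x, z) \<in> reachable (F - {{x, y}})" for z
    using that unfolding reachable_def
  proof (induction rule: rtrancl_induct)
    case base
    show ?case using xW by (simp add: W'_def)
  next
    case (step u v)
    then have uv: "{u, v} \<in> F - {{x, y}}" by simp
    have "v \<in> W" using we(4) uv by (auto simp: simple_graph_def doubleton_eq_iff)
    moreover have "(x, v) \<in> reachable (F - {{x, y}})"
      using step.IH reachable_edge[OF uv] reachable_trans by (auto simp: W'_def)
    ultimately have "v \<in> W'" by (simp add: W'_def)
    moreover from this have "{u, v} \<in> F'" using uv step.IH by (simp add: F'_def)
    ultimately show ?case using step.IH by (auto intro: rtrancl_into_rtrancl)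
  qed
  have yW': "y \<notin> W'"
  proof
    assume "y \<in> W'"
    then have "(x, y) \<in> reachable (E - {{x, y}})"
      using reachable_mono[of "F - {{x, y}}" "E - {{x, y}}"] we(1) by (auto simp: W'_def)
    then show False using bridge e we(1) by blast
  qed
  have "simple_graph W' F'"
    using we(4) unfolding simple_graph_def F'_def by fastforce
  then have "subgraph W' F' V E" using we by (auto simp: subgraph_def W'_def F'_def)
  moreover have "connected_graph W' F'"
    using reach xW by (intro connected_graph_from_vertex[of x]) (auto simp: W'_def)
  moreover have "F' \<inter> (insert {x, y} M \<union> B) = {}" using we(2) by (auto simp: F'_def)
  moreover have "2 * l + vertex_degree B z \<le>
      Suc (vertex_degree E z + vertex_degree (insert {x, y} M) z + vertex_degree F' z)"
    if z: "z \<in> W'" for z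
  proof -
    have "{x, y} \<notin> F'" "finite F'" "{x, y} \<notin> M" "finite M"
      using we(2,3) e M finite_subset_E by (auto simp: F'_def)
    \<comment> \<open>Apart from \<open>{x, y}\<close>, no edge of \<open>F\<close> leaves the
      component, so \<open>z\<close> loses at most that one edge.\<close>
    have "{d \<in> F. z \<in> d} \<subseteq> {d \<in> insert {x, y} F'. z \<in> d}"
    proof
      fix d assume d: "d \<in> {d \<in> F. z \<in> d}"
      show "d \<in> {d \<in> insert {x, y} F'. z \<in> d}"
      proof (cases "d = {x, y}")
        case False
        then have dF: "d \<in> F - {{x, y}}" using d by simp
        then obtain u where u: "d = {z, u}" "u \<in> W"
          using simple_graph_other_endE[OF we(4)] d by blast
        then have "(z, u) \<in> reachable (F - {{x, y}})"
          using dF by (intro reachable_edge) simp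
        then have "(x, u) \<in> reachable (F - {{x, y}})"
          by (rule reachable_trans[rotated]) (use z in \<open>simp add: W'_def\<close>)
        then have "u \<in> W'" using u by (simp add: W'_def)
        then show ?thesis using dF u z by (auto simp: F'_def)
      qed (use d in auto)
    qed
    then have "vertex_degree F z \<le> vertex_degree (insert {x, y} F') z"
      unfolding vertex_degree_def using \<open>finite F'\<close> by (intro card_mono) auto
    moreover have "2 * l + vertex_degree B z \<le> Suc (vertex_degree E z + vertex_degree M z + vertex_degree F z)"
      using w z by (simp add: witness_def W'_def)
    ultimately show ?thesis
      using \<open>{x, y} \<notin> F'\<close> \<open>finite F'\<close> \<open>{x, y} \<notin> M\<close> \<open>finite M\<close>
      by (auto simp: vertex_degree_insert split: if_splits)
  qed
  ultimately show "witness (insert {x, y} M) B {z \<in> W. (x, z) \<in> reachable (F - {{x, y}})} F'"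
    unfolding W'_def[symmetric] witness_def by blast
qed

text \<open>
  Claiming an edge of the witness splits it into two witnesses, and since the graph is acyclic
  Breaker's next edge cannot meet both of them.
\<close>

lemma live_maker_move_edge:
  assumes w: "witness M B W F" and "F \<noteq> {}" and MB: "M \<union> B \<subseteq> E"
  shows "\<exists>e\<in>E - (M \<union> B). live (insert e M) B \<and>
    (\<forall>f\<in>E - insert e (M \<union> B). live (insert e M) (insert f B))"
proof -
  note we = witness_edges[OF w]
  obtain x y where xy: "{x, y} \<in> F" "x \<noteq> y"
    using simple_graph_edgeE[OF we(4)] \<open>F \<noteq> {}\<close> by (metis all_not_in_conv)
  let ?e = "{x, y}"
  define W1 where "W1 = {z \<in> W. (x, z) \<in> reachable (F - {?e})}"
  define W2 where "W2 = {z \<in> W. (y, z) \<in> reachable (F - {?e})}"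
  obtain F1 where F1: "witness (insert ?e M) B W1 F1"
    using witness_split[OF w xy] MB by (auto simp: W1_def)
  obtain F2 where F2: "witness (insert ?e M) B W2 F2"
    using witness_split[OF w, of y x] xy MB by (auto simp: W2_def insert_commute)
  have sub: "reachable (F - {?e}) \<subseteq> reachable (E - {?e})"
    using we(1) by (intro reachable_mono) auto
  have "live (insert ?e M) (insert f B)" if f: "f \<in> E - insert ?e (M \<union> B)" for f
  proof (cases "f \<inter> W1 = {} \<or> f \<inter> W2 = {}")
    case True
    then show ?thesis
      using witness_untouched[OF F1, of f] witness_untouched[OF F2, of f] f MB by (auto simp: live_def)
  next
    case False
    then obtain a b where ab: "a \<in> f" "a \<in> W1" "b \<in> f" "b \<in> W2" by auto
    \<comment> \<open>An edge meeting both parts would provide a route from \<open>x\<close> to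
      \<open>y\<close> around the bridge.\<close>
    have "a = b \<or> f = {a, b}" using f simple ab(1,3) by (auto simp: simple_graph_def)
    then have "(a, b) \<in> reachable (E - {?e})" using f by (auto intro: reachable_edge)
    moreover have "(x, a) \<in> reachable (E - {?e})" "(b, y) \<in> reachable (E - {?e})"
      using ab sub by (auto simp: W1_def W2_def intro: reachable_sym)
    ultimately have "(x, y) \<in> reachable (E - {?e})" by (meson reachable_trans)
    then show ?thesis using bridge xy we(1) by blast
  qed
  moreover have "?e \<in> E - (M \<union> B)" using xy we by auto
  moreover have "live (insert ?e M) B" using F1 by (auto simp: live_def)
  ultimately show ?thesis by blast
qed

text \<open>A Maker edge at \<open>x\<close> pays in advance for the one Breaker edge that may
  follow there.\<close>

lemma live_maker_move_singleton:
  assumes w: "witness M B {x} {}" and MB: "M \<union> B \<subset> E"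
  shows "\<exists>e\<in>E - (M \<union> B). live (insert e M) B \<and>
    (\<forall>f\<in>E - insert e (M \<union> B). live (insert e M) (insert f B))"
proof -
  \<comment> \<open>An unclaimed edge at \<open>x\<close> is preferred; if there is none, the
    degrees at \<open>x\<close> are final and any unclaimed edge will do.\<close>
  obtain e where e: "e \<in> E - (M \<union> B)" "x \<in> e \<or> (\<forall>f\<in>E - (M \<union> B). x \<notin> f)"
    using MB by blast
  have fin: "finite M" "finite B" using MB finite_subset_E by auto
  have "witness (insert e M) B {x} {}"
    using w e fin by (auto simp: witness_singleton_iff vertex_degree_insert)
  moreover have "witness (insert e M) (insert f B) {x} {}" if "f \<in> E - insert e (M \<union> B)" for f
    using w e fin that by (auto simp: witness_singleton_iff vertex_degree_insert)
  ultimately show ?thesis using e(1) by (auto simp: live_def)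
qed

lemma live_maker_move:
  assumes "live M B" and MB: "M \<union> B \<subset> E"
  shows "\<exists>e\<in>E - (M \<union> B). live (insert e M) B \<and>
    (\<forall>f\<in>E - insert e (M \<union> B). live (insert e M) (insert f B))"
proof -
  obtain W F where w: "witness M B W F" using assms(1) by (auto simp: live_def)
  show ?thesis
  proof (cases "F = {}")
    case True
    \<comment> \<open>Without \<open>F\<close>-edges, the inequality at one vertex already makes
      that vertex a witness on its own.\<close>
    obtain x where "x \<in> W" using w by (auto simp: witness_def connected_graph_def)
    then have "witness M B {x} {}"
      using w True by (auto simp: witness_singleton_iff) (auto simp: witness_def subgraph_def)
    then show ?thesis using live_maker_move_singleton MB by blast
  next
    case False
    then show ?thesis using live_maker_move_edge[OF w] MB by blast
  qed
qed

section \<open>Breaker's reply: gluing witnesses\<close>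

text \<open>Converse of splitting: with \<open>{x, y}\<close> counted in \<open>F\<close> instead of
  \<open>M\<close>, the sum of degrees at its ends is restored, and further edges of the union only
  help. Hence, from a position that is not live, Maker's edge cannot create witnesses at both
  ends.\<close>

lemma witness_glue:
  assumes w1: "witness (insert {x, y} M) B W1 F1" "x \<in> W1"
    and w2: "witness (insert {x, y} M) B W2 F2" "y \<in> W2"
    and e: "{x, y} \<in> E - (M \<union> B)" "x \<noteq> y" and M: "M \<subseteq> E"
  shows "witness M B (W1 \<union> W2) (insert {x, y} (F1 \<union> F2))"
proof -
  let ?F = "insert {x, y} (F1 \<union> F2)"
  note we1 = witness_edges[OF w1(1)] and we2 = witness_edges[OF w2(1)]
  have "simple_graph (W1 \<union> W2) ?F"
    unfolding simple_graph_def
  proof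
    fix d assume "d \<in> ?F"
    then consider "d = {x, y}" | "d \<in> F1" | "d \<in> F2" by blast
    then show "\<exists>u\<in>W1 \<union> W2. \<exists>v\<in>W1 \<union> W2. u \<noteq> v \<and> d = {u, v}"
    proof cases
      case 1
      then show ?thesis using w1(2) w2(2) e(2) by blast
    next
      case 2
      then show ?thesis by (rule simple_graph_edgeE[OF we1(4)]) blast
    next
      case 3
      then show ?thesis by (rule simple_graph_edgeE[OF we2(4)]) blast
    qed
  qed
  then have "subgraph (W1 \<union> W2) ?F V E" using we1 we2 e(1) by (auto simp: subgraph_def)
  moreover have "connected_graph (W1 \<union> W2) ?F"
  proof (rule connected_graph_from_vertex)
    show "x \<in> W1 \<union> W2" using w1(2) by simp
    fix z assume z: "z \<in> W1 \<union> W2"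
    have sub: "reachable F1 \<subseteq> reachable ?F" "reachable F2 \<subseteq> reachable ?F"
      by (auto intro!: reachable_mono)
    have "(x, y) \<in> reachable ?F" by (rule reachable_edge) simp
    then show "(x, z) \<in> reachable ?F"
      using z sub witness_reachable[OF w1(1,2)] witness_reachable[OF w2(1,2)]
      by (blast intro: reachable_trans)
  qed
  moreover have "?F \<inter> (M \<union> B) = {}" using we1(2) we2(2) e(1) by auto
  \<comment> \<open>Stated for arbitrary \<open>W'\<close> and \<open>F'\<close> so that it applies
    to both sides of the union.\<close>
  moreover have "2 * l + vertex_degree B z \<le>
      Suc (vertex_degree E z + vertex_degree M z + vertex_degree ?F z)"
    if "witness (insert {x, y} M) B W' F'" "z \<in> W'" "F' \<subseteq> F1 \<union> F2" for z W' F'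
  proof -
    have "{x, y} \<notin> F'" "finite F'" using witness_edges[OF that(1)] by auto
    moreover have "{x, y} \<notin> M" "finite M" using e M finite_subset_E by auto
    moreover have "vertex_degree (insert {x, y} F') z \<le> vertex_degree ?F z"
      using that(3) we1(3) we2(3) by (intro vertex_degree_mono) auto
    moreover have "2 * l + vertex_degree B z \<le>
        Suc (vertex_degree E z + vertex_degree (insert {x, y} M) z + vertex_degree F' z)"
      using that by (simp add: witness_def)
    ultimately show ?thesis by (auto simp: vertex_degree_insert split: if_splits)
  qed
  from this[OF w1(1)] this[OF w2(1)] have
    "\<forall>z\<in>W1 \<union> W2. 2 * l + vertex_degree B z \<le> Suc (vertex_degree E z + vertex_degree M z + vertex_degree ?F z)"
    by blast
  ultimately show ?thesis by (simp add: witness_def)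
qed

text \<open>
  By gluing, after Maker claims \<open>{x, y}\<close> witnesses can arise on one side only, say at \<open>x\<close>. A
  Breaker edge at \<open>x\<close> restores the balance there, and by parity such an edge is still unclaimed.
\<close>

lemma not_live_breaker_reply_at:
  assumes nl: "\<not> live M B" and MB: "M \<inter> B = {}" "M \<union> B \<subseteq> E"
    and e: "{x, y} \<in> E - (M \<union> B)" "x \<noteq> y"
    and w: "witness (insert {x, y} M) B W F" "x \<in> W"
  shows "\<exists>f\<in>E - insert {x, y} (M \<union> B). \<not> live (insert {x, y} M) (insert f B)"
proof -
  let ?e = "{x, y}"
  have fin: "finite M" "finite B" using MB finite_subset_E by auto
  note we = witness_edges[OF w(1)]
  have "\<exists>f\<in>E - insert ?e (M \<union> B). x \<in> f"
  proof (rule ccontr)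
    assume "\<not> ?thesis"
    then have none: "\<And>f. f \<in> E \<Longrightarrow> x \<in> f \<Longrightarrow> f \<in> insert ?e (M \<union> B)" by blast
    have "{d \<in> E. x \<in> d} = {d \<in> insert ?e (M \<union> B). x \<in> d}" using none MB e by auto
    then have "vertex_degree E x = Suc (vertex_degree M x + vertex_degree B x)"
      using vertex_degree_insert[of "M \<union> B" ?e x] fin e MB
      by (simp add: vertex_degree_def[of E] vertex_degree_def[of "insert _ _"] vertex_degree_Un)
    moreover have "{d \<in> F. x \<in> d} = {}" using none we by auto
    then have "vertex_degree F x = 0" unfolding vertex_degree_def by (simp only: card.empty)
    moreover have "2 * l + vertex_degree B x \<le>
        Suc (vertex_degree E x + vertex_degree (insert ?e M) x + vertex_degree F x)"
      using w by (simp add: witness_def)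
    moreover have "\<not> 2 * l + vertex_degree B x \<le> Suc (vertex_degree E x + vertex_degree M x)"
      using nl w(2) we(5) witness_singleton_iff unfolding live_def by blast
    \<comment> \<open>The two bounds differ by one and force
      \<open>2 * l + d_B = d_E + d_M + 2\<close> at \<open>x\<close>. As
      \<open>d_E = d_M + d_B + 1\<close>, this gives \<open>2 * l = 2 * d_M + 3\<close>, impossible
      by parity.\<close>
    ultimately show False using fin e by (simp add: vertex_degree_insert) presburger
  qed
  then obtain f where f: "f \<in> E - insert ?e (M \<union> B)" "x \<in> f" by blast
  have "\<not> witness (insert ?e M) (insert f B) W' F'" for W' F'
  proof
    assume w': "witness (insert ?e M) (insert f B) W' F'"
    note we' = witness_edges[OF w']
    have wB: "witness (insert ?e M) B W' F'"
      using witness_antimono[OF w'] f MB by auto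
    \<comment> \<open>Otherwise this witness and \<open>W\<close>, which contains \<open>x\<close>,
      would glue to a witness of the original position.\<close>
    have "y \<notin> W'" using witness_glue[OF w wB _ e] nl MB by (auto simp: live_def)
    \<comment> \<open>At \<open>x\<close> the edge \<open>f\<close> cancels Maker's gain; no other
      vertex of \<open>W'\<close> lies on Maker's edge. So \<open>W'\<close> was a witness before
      the exchange.\<close>
    have "2 * l + vertex_degree B z \<le> Suc (vertex_degree E z + vertex_degree M z + vertex_degree F' z)"
      if z: "z \<in> W'" for z
    proof -
      have "2 * l + vertex_degree (insert f B) z \<le>
          Suc (vertex_degree E z + vertex_degree (insert ?e M) z + vertex_degree F' z)"
        using w' z by (simp add: witness_def)
      then show ?thesis
        using fin e f z \<open>y \<notin> W'\<close> by (auto simp: vertex_degree_insert split: if_splits)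
    qed
    then have "witness M B W' F'" using w' by (auto simp: witness_def)
    then show False using nl by (auto simp: live_def)
  qed
  then show ?thesis using f(1) by (auto simp: live_def)
qed

text \<open>A witness avoiding both ends of Maker's edge would have existed before it was claimed,
  so a new one contains an end, and the two ends play symmetric roles.\<close>

lemma not_live_breaker_reply:
  assumes nl: "\<not> live M B" and MB: "M \<inter> B = {}" "M \<union> B \<subseteq> E"
    and e: "e \<in> E - (M \<union> B)" and live: "live (insert e M) B"
  shows "\<exists>f\<in>E - insert e (M \<union> B). \<not> live (insert e M) (insert f B)"
proof -
  have "e \<in> E" using e by simp
  then obtain x y where xy: "e = {x, y}" "x \<noteq> y"
    by (rule simple_graph_edgeE[OF simple])
  obtain W F where w: "witness (insert e M) B W F" using live by (auto simp: live_def)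
  have "x \<in> W \<or> y \<in> W"
  proof (rule ccontr)
    assume "\<not> ?thesis"
    then have "vertex_degree (insert e M) z = vertex_degree M z" if "z \<in> W" for z
      using that xy e MB finite_subset_E by (auto simp: vertex_degree_insert)
    then have "witness M B W F" using w by (auto simp: witness_def)
    then show False using nl by (auto simp: live_def)
  qed
  then show ?thesis
    using not_live_breaker_reply_at[OF nl MB, of x y W F]
      not_live_breaker_reply_at[OF nl MB, of y x W F, unfolded insert_commute[of y x]]
      e w xy(2) unfolding xy(1) by blast
qed

text \<open>For the case that Maker's edge creates no witness: then no Breaker edge creates one
  either, and any reply serves.\<close>

lemma live_breaker_antimono:
  assumes "live M (insert f B)" "insert f B \<subseteq> E"
  shows "live M B"
proof -
  obtain W F where "witness M (insert f B) W F" using assms(1) by (auto simp: live_def)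
  then have "witness M B W F" using assms(2) by (rule witness_antimono[OF _ subset_insertI])
  then show ?thesis by (auto simp: live_def)
qed

section \<open>Full boards and the equivalence\<close>

text \<open>On a full board \<open>F\<close> is empty and \<open>d_E = d_M + d_B\<close>, so the
  inequality becomes \<open>2 * l \<le> 2 * d_M + 1\<close>, that is
  \<open>l \<le> d_M\<close>.\<close>

lemma live_full_iff:
  assumes "M \<inter> B = {}" "M \<union> B = E"
  shows "live M B \<longleftrightarrow> (\<exists>x\<in>V. l \<le> vertex_degree M x)"
proof -
  have fin: "finite M" "finite B" using finite_E[folded assms(2)] by simp_all
  have deg: "vertex_degree E x = vertex_degree M x + vertex_degree B x" for x
    using vertex_degree_Un[OF fin assms(1)] unfolding assms(2) .
  show ?thesis
  proof
    assume "live M B"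
    then obtain W F where w: "witness M B W F" by (auto simp: live_def)
    then obtain x where x: "x \<in> W" by (auto simp: witness_def connected_graph_def)
    have "F = {}" using witness_edges[OF w] assms(2) by auto
    then have "2 * l + vertex_degree B x \<le> Suc (vertex_degree E x + vertex_degree M x)"
      using w x by (auto simp: witness_def)
    then have "l \<le> vertex_degree M x" using deg by simp
    then show "\<exists>x\<in>V. l \<le> vertex_degree M x" using x witness_edges(5)[OF w] by blast
  next
    assume "\<exists>x\<in>V. l \<le> vertex_degree M x"
    then obtain x where "x \<in> V" "l \<le> vertex_degree M x" by blast
    then have "witness M B {x} {}" using deg by (simp add: witness_singleton_iff)
    then show "live M B" by (auto simp: live_def)
  qed
qed

text \<open>Maker can preserve \<open>live\<close>, Breaker can preserve its negation, and on a full
  board \<open>live\<close> says that Maker owns a star.\<close>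

lemma maker_wins_iff_live:
  assumes "l \<ge> 1"
  shows "maker_has_winning_strategy E (star_winning_sets V E l) \<longleftrightarrow> live {} {}"
proof
  have full: "(\<exists>A\<in>star_winning_sets V E l. A \<subseteq> M) \<longleftrightarrow> live M B"
    if "M \<inter> B = {}" "M \<union> B = E" for M B
    using live_full_iff[OF that] star_winning_set_iff[OF simple finite_E _ assms] that by blast
  show "maker_has_winning_strategy E (star_winning_sets V E l)" if "live {} {}"
    by (rule maker_wins_by_invariant[of live]) (use that live_maker_move full in auto)
  show "live {} {}" if win: "maker_has_winning_strategy E (star_winning_sets V E l)"
  proof (rule ccontr)
    assume nl: "\<not> live {} {}"
    have "\<not> maker_has_winning_strategy E (star_winning_sets V E l)"
    proof (rule breaker_wins_by_invariant[of _ "\<lambda>M B. \<not> live M B", OF finite_E nl])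
      fix M B e
      assume a: "\<not> live M B" "M \<inter> B = {}" "M \<union> B \<subseteq> E" "e \<in> E - (M \<union> B)"
      note reply = not_live_breaker_reply[OF a]
      show "if E = insert e (M \<union> B) then \<not> live (insert e M) B
        else \<exists>f\<in>E - insert e (M \<union> B). \<not> live (insert e M) (insert f B)"
      \<comment> \<open>Only a position that Maker has just made live needs a chosen answer.\<close>
      proof (cases "live (insert e M) B")
        case True
        then show ?thesis using reply by auto
      next
        case False
        then have "\<not> live (insert e M) (insert f B)" if "f \<in> E" for f
          using live_breaker_antimono that a(3) by blast
        then show ?thesis using False a(3,4) by auto
      qed
    qed (use full in auto)
    then show False using win by blast
  qed
qed

end

theorem theorem16:
  fixes V :: "'a set" and E :: "'a set set" and l :: nat
  assumes "finite_tree V E" and "l \<ge> 1"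
  shows "maker_has_winning_strategy E (star_winning_sets V E l) \<longleftrightarrow>
    (\<exists>W F. subgraph W F V E \<and> connected_graph W F \<and>
       (\<forall>x\<in>W. int (vertex_degree E x) \<ge> 2 * int l - 1 - int (vertex_degree F x)))"
proof -
  interpret tree_star_game V E l
    using assms(1) by unfold_locales
  \<comment> \<open>Translates the additive inequality over the naturals into the integer form with
    subtraction.\<close>
  have "2 * l \<le> Suc (a + b) \<longleftrightarrow> int a \<ge> 2 * int l - 1 - int b" for a b
    by linarith
  then show ?thesis
    unfolding maker_wins_iff_live[OF assms(2)] live_def witness_def
    by (simp only: vertex_degree_empty Un_empty_right Int_empty_right add_0_right simp_thms)
qed

end
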